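(* Let $f$ and $g$ be real polynomials in two real variables whose degrees are not greater than $d$ and such that $f(0)=g(0)=0$. Put $V_f=f^{-1}(0)\subset\mathbb{R}^2$ and $V_g=g^{-1}(0)\subset\mathbb{R}^2$. Then there exist positive numbers $C$ and $r$ such that $$d(x,V_f)+d(x,V_g)\ \ge\ C\,d(x,V_f\cap V_g)^{\frac{(2d-1)^2+1}{2}}\qquad\text{for all } x\in\mathbb{R}^2 \text{ with } \|x\|\le r.$$
   Context: $d(x,X)$ denotes the Euclidean distance from the point $x\in\mathbb{R}^2$ to the set $X\subset\mathbb{R}^2$, while $d$ in the exponent is the integer bounding the degrees of $f$ and $g$. *)

theory Defs
  imports "HOL-Analysis.Analysis" "HOL-Computational_Algebra.Polynomial"
begin

text \<open>
  A polynomial in two real variables \<open>X\<close>, \<open>Y\<close> is an element of \<open>\<real>[X][Y]\<close>: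
  \<open>coeff (coeff p j) i\<close> is the coefficient of \<open>X\<^sup>i Y\<^sup>j\<close>.
\<close>

definition eval2 :: "real poly poly \<Rightarrow> real^2 \<Rightarrow> real" where
  "eval2 p x = poly (poly p [:x $ 2:]) (x $ 1)"

text \<open>The degree with respect to both variables jointly; the zero polynomial gets degree \<open>0\<close>.\<close>

definition total_degree :: "'a::zero poly poly \<Rightarrow> nat" where
  "total_degree p = Max (insert 0 {i + j | i j. coeff (coeff p j) i \<noteq> 0})"

definition zero_locus :: "real poly poly \<Rightarrow> (real^2) set" where
  "zero_locus p = {x. eval2 p x = 0}"

lemma finite_support2: "finite {i + j | i j. coeff (coeff p j) i \<noteq> (0::'a::zero)}"
proof (rule finite_subset)
  show "{i + j | i j. coeff (coeff p j) i \<noteq> 0}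
      \<subseteq> (\<lambda>(i, j). i + j) ` (SIGMA i:(\<Union>j\<le>degree p. {..degree (coeff p j)}). {..degree p})"
  proof clarify
    fix i j assume ij: "coeff (coeff p j) i \<noteq> 0"
    then have "coeff p j \<noteq> 0" by auto
    then have "j \<le> degree p" by (rule le_degree)
    moreover have "i \<le> degree (coeff p j)" using ij by (rule le_degree)
    ultimately show "i + j \<in> (\<lambda>(i, j). i + j) `
        (SIGMA i:(\<Union>j\<le>degree p. {..degree (coeff p j)}). {..degree p})"
      by (intro image_eqI[where x = "(i, j)"]) auto
  qed
qed auto

lemma total_degree_le_iff:
  "total_degree p \<le> d \<longleftrightarrow> (\<forall>i j. coeff (coeff p j) i \<noteq> 0 \<longrightarrow> i + j \<le> d)"
  unfolding total_degree_def using finite_support2[of p] by (subst Max_le_iff) auto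

lemma eval2_altdef:
  "eval2 p x = (\<Sum>j\<le>degree p. \<Sum>i\<le>degree (coeff p j).
     coeff (coeff p j) i * (x $ 1) ^ i * (x $ 2) ^ j)"
proof -
  have "eval2 p x = (\<Sum>j\<le>degree p. poly (coeff p j) (x $ 1) * (x $ 2) ^ j)"
    unfolding eval2_def poly_altdef[of p] by (simp add: poly_sum)
  then show ?thesis
    by (simp add: poly_altdef sum_distrib_right)
qed

end

theory Submission
  imports Defs "Subresultants.Subresultant_Gcd" "HOL-Computational_Algebra.Field_as_Ring"
begin

text \<open>
  Write \<open>f = h f\<^sub>1\<close> and \<open>g = h g\<^sub>1\<close> with \<open>h = gcd f g\<close>, so that
  \<open>V(f) \<inter> V(g) = V(h) \<union> (V(f\<^sub>1) \<inter> V(g\<^sub>1))\<close>. If a nearest point of \<open>V(f)\<close> or \<open>V(g)\<close> lies on \<open>V(h)\<close>, the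
  estimate is linear. Otherwise both nearest points lie on the loci of the coprime polynomials
  \<open>f\<^sub>1\<close>, \<open>g\<^sub>1\<close>, which then both vanish at \<open>0\<close>. Their resultants with respect to either variable are
  nonzero one-variable polynomials of degree at most \<open>d\<^sup>2\<close> in the ideal \<open>(f\<^sub>1, g\<^sub>1)\<close>, whence
  \<open>|x|^(d\<^sup>2) \<le> const (|f\<^sub>1 x| + |g\<^sub>1 x|)\<close> near \<open>0\<close>, and the right-hand side is bounded by the distances
  because polynomials are locally Lipschitz. The claimed exponent is \<open>d\<^sup>2 + (d - 1)\<^sup>2 \<ge> d\<^sup>2\<close>.
\<close>

section \<open>The resultant of two plane curves\<close>

text \<open>The last row of \<open>subresultant_mat 0 F G\<close> consists of monomial multiples of
  \<open>F\<close> and \<open>G\<close>, so the Laplace expansion along it displays the determinant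
  as a combination of the two. The degree hypothesis ensures that there is a last row.\<close>

lemma resultant_in_ideal:
  fixes F G :: "'a::comm_ring_1 poly"
  assumes "degree F + degree G > 0"
  shows "\<exists>A B. [:resultant F G:] = A * F + B * G"
proof -
  define n where "n = degree F + degree G"
  define M where "M = subresultant_mat 0 F G"
  have M: "M \<in> carrier_mat n n"
    unfolding M_def n_def by (intro carrier_matI) auto
  have entry: "\<exists>A B. M $$ (n - 1, j) = A * F + B * G" if "j < n" for j
  proof (cases "j < degree G")
    case True
    then have "M $$ (n - 1, j) = monom 1 (degree G - 1 - j) * F + 0 * G"
      using that assms unfolding M_def n_def by (subst subresultant_index_mat) auto
    then show ?thesis by blast
  next
    case False
    then have "M $$ (n - 1, j) = 0 * F + monom 1 (degree F - 1 - (j - degree G)) * G"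
      using that assms unfolding M_def n_def by (subst subresultant_index_mat) auto
    then show ?thesis by blast
  qed
  then obtain A B where AB: "\<And>j. j < n \<Longrightarrow> M $$ (n - 1, j) = A j * F + B j * G"
    by metis
  have "[:resultant F G:] = Determinant.det M"
    unfolding M_def subresultant_resultant[symmetric] subresultant_def ..
  also have "\<dots> = (\<Sum>j<n. M $$ (n - 1, j) * cofactor M (n - 1) j)"
    using assms by (intro laplace_expansion_row[OF M]) (simp add: n_def)
  also have "\<dots> = (\<Sum>j<n. (A j * F + B j * G) * cofactor M (n - 1) j)"
    using AB by (intro sum.cong) auto
  also have "\<dots> = (\<Sum>j<n. A j * cofactor M (n - 1) j) * F + (\<Sum>j<n. B j * cofactor M (n - 1) j) * G"
    by (simp add: sum_distrib_left sum.distrib algebra_simps)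
  finally show ?thesis by blast
qed

lemma degree_coeff_le_total_degree:
  assumes "total_degree p \<le> d" "coeff p j \<noteq> 0"
  shows "degree (coeff p j) + j \<le> d"
  using assms leading_coeff_neq_0[of "coeff p j"] unfolding total_degree_le_iff by blast

lemma degree_le_total_degree:
  assumes "total_degree p \<le> d"
  shows "degree p \<le> d"
proof (cases "p = 0")
  case False
  then show ?thesis
    using degree_coeff_le_total_degree[OF assms, of "degree p"] by simp
qed simp

text \<open>Each term of the Leibniz expansion is bounded by weighing entry \<open>(i, j)\<close> of the Sylvester
  matrix with \<open>j - i\<close>, which cancels over a permutation.\<close>

lemma degree_resultant_le:
  fixes F G :: "'a::comm_ring_1 poly poly"
  assumes F: "total_degree F \<le> d" and G: "total_degree G \<le> e"
  shows "degree (resultant F G) \<le> d * e"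
proof -
  define m n N where "m = degree F" and "n = degree G" and "N = m + n"
  define S where "S = sylvester_mat F G"
  \<comment> \<open>Row \<open>i\<close> carries \<open>coeff F (m + i - j)\<close> for
    \<open>i < n\<close> and \<open>coeff G (i - j)\<close> below. The total degree bounds limit
    their degrees to \<open>d - (m + i - j)\<close> and \<open>e - (i - j)\<close>;
    \<open>w i\<close> is what remains after removing \<open>j - i\<close>.\<close>
  define w :: "nat \<Rightarrow> int" where "w i = (if i < n then int d - int m else int e)" for i
  have md: "m \<le> d" and ne: "n \<le> e"
    using degree_le_total_degree[OF F] degree_le_total_degree[OF G] by (auto simp: m_def n_def)
  have S: "S \<in> carrier_mat N N"
    unfolding S_def N_def m_def n_def by (rule sylvester_carrier_mat)
  have entry: "int (degree (S $$ (i, j))) \<le> w i + int j - int i"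
    if "i < N" "j < N" "S $$ (i, j) \<noteq> 0" for i j
  proof (cases "i < n")
    case True
    then have *: "S $$ (i, j) = coeff F (m + i - j)" "i \<le> j" "j - i \<le> m"
      using that unfolding S_def N_def m_def n_def
      by (simp_all add: sylvester_index_mat split: if_splits)
    then show ?thesis
      using degree_coeff_le_total_degree[OF F, of "m + i - j"] that True by (simp add: w_def)
  next
    case False
    then have *: "S $$ (i, j) = coeff G (i - j)" "j \<le> i"
      using that unfolding S_def N_def m_def n_def
      by (simp_all add: sylvester_index_mat split: if_splits)
    then show ?thesis
      using degree_coeff_le_total_degree[OF G, of "i - j"] that False by (simp add: w_def)
  qed
  have prod: "degree (\<Prod>i = 0..<N. S $$ (i, p i)) \<le> d * e" if p: "p permutes {0..<N}" for p
  \<comment> \<open>The weight bound may be negative at a zero entry, whose degree is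
    \<open>0\<close> by convention. A product with such a factor vanishes anyway.\<close>
  proof (cases "\<exists>i\<in>{0..<N}. S $$ (i, p i) = 0")
    case True
    then have "(\<Prod>i = 0..<N. S $$ (i, p i)) = 0"
      by (intro prod_zero) auto
    then show ?thesis by simp
  next
    case False
    have pN: "p i < N" if "i < N" for i
      using permutes_in_image[OF p, of i] that by simp
    have "int (degree (\<Prod>i = 0..<N. S $$ (i, p i))) \<le> int (\<Sum>i = 0..<N. degree (S $$ (i, p i)))"
      using degree_prod_sum_le[of "{0..<N}" "\<lambda>i. S $$ (i, p i)"] by (simp only: of_nat_le_iff o_def finite_atLeastLessThan)
    also have "\<dots> \<le> (\<Sum>i = 0..<N. w i + int (p i) - int i)"
      unfolding of_nat_sum using False pN by (intro sum_mono entry) auto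
    also have "\<dots> = (\<Sum>i = 0..<N. w i) + (\<Sum>i = 0..<N. int (p i)) - (\<Sum>i = 0..<N. int i)"
      by (simp add: sum.distrib sum_subtractf)
    also have "(\<Sum>i = 0..<N. int (p i)) = (\<Sum>i = 0..<N. int i)"
      using sum.permute[OF p, of int] by (simp add: o_def)
    also have "(\<Sum>i = 0..<N. w i) = (\<Sum>i = 0..<n. w i) + (\<Sum>i = n..<N. w i)"
      by (rule sum.atLeastLessThan_concat[symmetric]) (auto simp: N_def)
    also have "(\<Sum>i = 0..<n. w i) = int n * (int d - int m)"
      by (simp add: w_def)
    also have "(\<Sum>i = n..<N. w i) = int m * int e"
      by (simp add: w_def N_def)
    finally have "int (degree (\<Prod>i = 0..<N. S $$ (i, p i))) \<le> int n * (int d - int m) + int m * int e"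
      by simp
    \<comment> \<open>In this form the difference from \<open>d * e\<close> is a product of two
      nonnegative factors.\<close>
    also have "\<dots> = int d * int e - (int d - int m) * (int e - int n)"
      by (simp add: algebra_simps)
    also have "\<dots> \<le> int (d * e)"
      using md ne by simp
    finally show ?thesis by (simp only: of_nat_le_iff)
  qed
  have "degree (signof p * (\<Prod>i = 0..<N. S $$ (i, p i))) \<le> d * e" if "p permutes {0..<N}" for p
    using prod[OF that] by (auto simp: sign_def)
  then show ?thesis
    unfolding resultant_def S_def[symmetric] det_def'[OF S]
    by (intro degree_sum_le) (auto intro: finite_permutations)
qed

section \<open>Exchanging the variables, and the total degree of a factor\<close>

text \<open>The automorphism exchanging \<open>X\<close> and \<open>Y\<close>. It lets elimination
  be carried out for one coordinate and then transferred to the other.\<close>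

definition swap_vars :: "'a::comm_semiring_1 poly poly \<Rightarrow> 'a poly poly" where
  "swap_vars p = (\<Sum>j\<le>degree p. map_poly (\<lambda>a. monom a j) (coeff p j))"

lemma coeff_swap_vars [simp]: "coeff (coeff (swap_vars p) j) i = coeff (coeff p i) j"
proof -
  have "coeff (coeff (swap_vars p) j) i = (\<Sum>k\<le>degree p. if k = i then coeff (coeff p k) j else 0)"
    unfolding swap_vars_def coeff_sum by (intro sum.cong) (simp_all add: coeff_map_poly)
  also have "\<dots> = coeff (coeff p i) j"
    by (simp add: coeff_eq_0)
  finally show ?thesis .
qed

lemma swap_vars_swap_vars [simp]: "swap_vars (swap_vars p) = p"
  by (intro poly_eqI) simp

lemma coeff2_mult:
  "coeff (coeff (p * q) j) i =
    (\<Sum>b\<le>j. \<Sum>a\<le>i. coeff (coeff p b) a * coeff (coeff q (j - b)) (i - a))"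
  by (simp add: coeff_mult coeff_sum)

lemma swap_vars_mult: "swap_vars (p * q) = swap_vars p * swap_vars q"
proof (intro poly_eqI)
  fix i j
  show "coeff (coeff (swap_vars (p * q)) j) i = coeff (coeff (swap_vars p * swap_vars q) j) i"
    by (simp add: coeff2_mult) (rule sum.swap)
qed

lemma swap_vars_dvd: "p dvd q \<Longrightarrow> swap_vars p dvd swap_vars q"
  by (auto simp: dvd_def swap_vars_mult)

lemma swap_vars_1 [simp]: "swap_vars 1 = 1"
  by (intro poly_eqI) auto

text \<open>The exchange is a multiplicative involution, so a common divisor of the images is
  carried back to one of \<open>p\<close> and \<open>q\<close>.\<close>

lemma coprime_swap_vars:
  assumes "coprime p q"
  shows "coprime (swap_vars p) (swap_vars q)"
proof (rule coprimeI)
  fix c assume "c dvd swap_vars p" "c dvd swap_vars q"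
  then have "swap_vars c dvd p" "swap_vars c dvd q"
    using swap_vars_dvd by fastforce+
  then have "swap_vars c dvd 1"
    using assms coprime_common_divisor by blast
  then show "c dvd 1"
    using swap_vars_dvd[of "swap_vars c" 1] by simp
qed

lemma total_degree_swap_vars_le:
  assumes "total_degree p \<le> d"
  shows "total_degree (swap_vars p) \<le> d"
  using assms unfolding total_degree_le_iff by (metis add.commute coeff_swap_vars)

lemma eval2_0 [simp]: "eval2 0 x = 0"
  by (simp add: eval2_def)

lemma eval2_add [simp]: "eval2 (p + q) x = eval2 p x + eval2 q x"
  by (simp add: eval2_def)

lemma eval2_mult [simp]: "eval2 (p * q) x = eval2 p x * eval2 q x"
  by (simp add: eval2_def)

lemma eval2_pCons [simp]: "eval2 (pCons c p) x = poly c (x $ 1) + x $ 2 * eval2 p x"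
  by (simp add: eval2_def)

lemma eval2_sum: "eval2 (\<Sum>i\<in>I. p i) x = (\<Sum>i\<in>I. eval2 (p i) x)"
  by (induction I rule: infinite_finite_induct) simp_all

lemma eval2_swap_vars: "eval2 (swap_vars p) x = eval2 p (vector [x $ 2, x $ 1])"
proof -
  have *: "eval2 (map_poly (\<lambda>a. monom a j) c) x = poly c (x $ 2) * x $ 1 ^ j" for c j
    by (induction c) (simp_all add: map_poly_pCons poly_monom algebra_simps)
  show ?thesis
    by (simp add: swap_vars_def eval2_sum * eval2_altdef[of p] poly_altdef sum_distrib_right)
qed

text \<open>Selects the leading monomial for the graded order that breaks ties by the exponent of
  \<open>Y\<close>, so that leading monomials can be multiplied.\<close>

lemma total_degree_leading_monomial:
  assumes "p \<noteq> 0"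
  obtains i j where "coeff (coeff p j) i \<noteq> 0" "i + j = total_degree p"
    "\<forall>i' j'. coeff (coeff p j') i' \<noteq> 0 \<longrightarrow> i' + j' = total_degree p \<longrightarrow> j' \<le> j"
proof -
  let ?P = "\<lambda>j. \<exists>i. coeff (coeff p j) i \<noteq> 0 \<and> i + j = total_degree p"
  obtain i0 j0 where nz: "coeff (coeff p j0) i0 \<noteq> 0"
    using assms by (metis leading_coeff_neq_0)
  have "\<exists>j. ?P j"
  proof (rule ccontr)
    assume neg: "\<not> (\<exists>j. ?P j)"
    have le: "i + j \<le> total_degree p" if "coeff (coeff p j) i \<noteq> 0" for i j
      using that total_degree_le_iff[of p "total_degree p"] by simp
    have "i + j \<le> total_degree p - 1" if "coeff (coeff p j) i \<noteq> 0" for i j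
      using le[OF that] neg that by (metis Suc_pred' le_neq_implies_less less_Suc_eq_le neq0_conv not_less0)
    \<comment> \<open>Subtraction is truncated, so this forces total degree \<open>0\<close>, and
      then the nonzero coefficient at \<open>(i0, j0)\<close> attains it.\<close>
    then have "total_degree p \<le> total_degree p - 1"
      unfolding total_degree_le_iff by blast
    then have "i0 + j0 = total_degree p"
      using le[OF nz] by linarith
    with neg nz show False by blast
  qed
  moreover have "\<forall>j. ?P j \<longrightarrow> j \<le> total_degree p"
    by auto
  ultimately obtain j where "?P j" "\<forall>j'. ?P j' \<longrightarrow> j' \<le> j"
    using Nat.ex_has_greatest_nat[of ?P _ "total_degree p"] by blast
  then show ?thesis
    using that by blast
qed

text \<open>At the product of the two leading monomials only one term of the convolution survives,
  and it is nonzero in a domain. This bounds the total degree of a cofactor.\<close>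

lemma total_degree_mult_ge:
  fixes p q :: "'a::idom poly poly"
  assumes "p \<noteq> 0" "q \<noteq> 0"
  shows "total_degree p + total_degree q \<le> total_degree (p * q)"
proof -
  obtain i1 j1 where p: "coeff (coeff p j1) i1 \<noteq> 0" "i1 + j1 = total_degree p"
    "\<forall>i' j'. coeff (coeff p j') i' \<noteq> 0 \<longrightarrow> i' + j' = total_degree p \<longrightarrow> j' \<le> j1"
    by (rule total_degree_leading_monomial[OF assms(1)])
  obtain i2 j2 where q: "coeff (coeff q j2) i2 \<noteq> 0" "i2 + j2 = total_degree q"
    "\<forall>i' j'. coeff (coeff q j') i' \<noteq> 0 \<longrightarrow> i' + j' = total_degree q \<longrightarrow> j' \<le> j2"
    by (rule total_degree_leading_monomial[OF assms(2)])
  let ?t = "\<lambda>b a. coeff (coeff p b) a * coeff (coeff q (j1 + j2 - b)) (i1 + i2 - a)"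
  have zero: "?t b a = 0" if "b \<le> j1 + j2" "a \<le> i1 + i2" "(b, a) \<noteq> (j1, i1)" for a b
  proof (rule ccontr)
    assume "?t b a \<noteq> 0"
    then have nz: "coeff (coeff p b) a \<noteq> 0" "coeff (coeff q (j1 + j2 - b)) (i1 + i2 - a) \<noteq> 0"
      by auto
    have "a + b \<le> total_degree p"
      using nz(1) total_degree_le_iff[of p "total_degree p"] by simp
    moreover have "(i1 + i2 - a) + (j1 + j2 - b) \<le> total_degree q"
      using nz(2) total_degree_le_iff[of q "total_degree q"] by blast
    \<comment> \<open>The two left-hand sides add up to
      \<open>total_degree p + total_degree q\<close>, so neither inequality can be strict.
      Maximality of \<open>j1\<close> and \<open>j2\<close> then pins \<open>b\<close> to
      \<open>j1\<close>, and hence \<open>a\<close> to \<open>i1\<close>.\<close>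
    ultimately have eq: "a + b = total_degree p" "(i1 + i2 - a) + (j1 + j2 - b) = total_degree q"
      using p(2) q(2) that by linarith+
    then have "b \<le> j1" "j1 + j2 - b \<le> j2"
      using p(3) q(3) nz by blast+
    then show False
      using eq p(2) that by auto
  qed
  have "coeff (coeff (p * q) (j1 + j2)) (i1 + i2) =
      (\<Sum>b\<le>j1 + j2. \<Sum>a\<le>i1 + i2. if (b, a) = (j1, i1) then ?t b a else 0)"
    unfolding coeff2_mult using zero by (intro sum.cong refl) auto
  also have "\<dots> = (\<Sum>(b, a)\<in>{..j1 + j2} \<times> {..i1 + i2}. if (b, a) = (j1, i1) then ?t b a else 0)"
    by (simp only: sum.cartesian_product)
  also have "\<dots> = (\<Sum>(b, a)\<in>{(j1, i1)}. ?t b a)"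
    by (intro sum.mono_neutral_cong_right) (auto split: if_splits)
  also have "\<dots> \<noteq> 0"
    using p(1) q(1) by simp
  finally have "(i1 + i2) + (j1 + j2) \<le> total_degree (p * q)"
    using total_degree_le_iff[of "p * q" "total_degree (p * q)"] by blast
  then show ?thesis
    using p(2) q(2) by linarith
qed

section \<open>Metric estimates\<close>

lemma lipschitz_on_mult_bounded:
  fixes f g :: "'a::metric_space \<Rightarrow> real"
  assumes f: "L-lipschitz_on X f" and g: "M-lipschitz_on X g"
    and bf: "\<And>x. x \<in> X \<Longrightarrow> \<bar>f x\<bar> \<le> A" and bg: "\<And>x. x \<in> X \<Longrightarrow> \<bar>g x\<bar> \<le> B"
    and "A \<ge> 0" "B \<ge> 0"
  shows "(A * M + B * L)-lipschitz_on X (\<lambda>x. f x * g x)"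
proof (rule lipschitz_onI)
  have L: "L \<ge> 0" and M: "M \<ge> 0"
    using f g lipschitz_on_nonneg by blast+
  fix x y assume xy: "x \<in> X" "y \<in> X"
  have "f x * g x - f y * g y = f x * (g x - g y) + g y * (f x - f y)"
    by (simp add: algebra_simps)
  then have "dist (f x * g x) (f y * g y) \<le> \<bar>f x\<bar> * dist (g x) (g y) + \<bar>g y\<bar> * dist (f x) (f y)"
    unfolding dist_real_def by (metis abs_mult abs_triangle_ineq)
  also have "\<dots> \<le> A * (M * dist x y) + B * (L * dist x y)"
    using xy assms L M by (intro add_mono mult_mono lipschitz_onD[OF f] lipschitz_onD[OF g]) auto
  finally show "dist (f x * g x) (f y * g y) \<le> (A * M + B * L) * dist x y"
    by (simp add: algebra_simps)
qed (use assms f g lipschitz_on_nonneg in \<open>auto intro!: add_nonneg_nonneg mult_nonneg_nonneg\<close>)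

lemma continuous_on_eval2 [continuous_intros]: "continuous_on S (eval2 p)"
  unfolding eval2_altdef[abs_def] by (intro continuous_intros)

lemma eval2_bounded:
  obtains K where "K > 0" "\<And>x. x \<in> cball 0 R \<Longrightarrow> \<bar>eval2 p x\<bar> \<le> K"
proof -
  have "bounded (eval2 p ` cball 0 R)"
    by (intro compact_imp_bounded compact_continuous_image continuous_on_eval2 compact_cball)
  then obtain K where "K > 0" "\<forall>y\<in>eval2 p ` cball 0 R. norm y \<le> K"
    unfolding bounded_pos by blast
  then show ?thesis
    by (intro that[of K]) auto
qed

text \<open>Induction along the Horner scheme, first in \<open>X\<close> for the coefficients, then
  in \<open>Y\<close>. Multiplication by a coordinate preserves the property because both factors
  are bounded on the ball.\<close>

lemma eval2_lipschitz: "\<exists>L. L-lipschitz_on (cball 0 R) (eval2 p)"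
proof -
  have coord: "1-lipschitz_on (cball 0 R) (\<lambda>x :: real^2. x $ k)" for k
    by (intro lipschitz_onI) (auto simp: dist_vec_nth_le)
  have lip_mult: "\<exists>N. N-lipschitz_on (cball 0 R) (\<lambda>x. f x * eval2 q x)"
    if f: "L-lipschitz_on (cball 0 R) f" "\<And>x. x \<in> cball 0 R \<Longrightarrow> \<bar>f x\<bar> \<le> \<bar>R\<bar>"
      and q: "\<exists>M. M-lipschitz_on (cball 0 R) (eval2 q)" for f L q
  proof -
    obtain M where "M-lipschitz_on (cball 0 R) (eval2 q)" using q by blast
    moreover obtain K where "K > 0" "\<And>x. x \<in> cball 0 R \<Longrightarrow> \<bar>eval2 q x\<bar> \<le> K"
      using eval2_bounded[of R q] by blast
    ultimately show ?thesis
      using lipschitz_on_mult_bounded[OF f(1), of M "eval2 q" "\<bar>R\<bar>" K] f(2) by auto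
  qed
  have coord_bound: "\<bar>x $ k\<bar> \<le> \<bar>R\<bar>" if "x \<in> cball 0 R" for x :: "real^2" and k
    using that component_le_norm_cart[of x k] by simp
  have const: "\<exists>L. L-lipschitz_on (cball 0 R) (eval2 [:c:])" for c
  proof (induction c)
    case 0
    then show ?case using lipschitz_on_constant[of "cball 0 R" 0] by auto
  next
    case (pCons a c)
    obtain N where "N-lipschitz_on (cball 0 R) (\<lambda>x. x $ 1 * eval2 [:c:] x)"
      using lip_mult[OF coord coord_bound pCons.IH] by blast
    from lipschitz_on_add[OF lipschitz_on_constant[of _ a] this] show ?case
      by auto
  qed
  show ?thesis
  proof (induction p)
    case 0
    then show ?case using lipschitz_on_constant[of "cball 0 R" 0] by auto
  next
    case (pCons c p)
    obtain M where "M-lipschitz_on (cball 0 R) (eval2 [:c:])" using const by blast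
    moreover obtain N where "N-lipschitz_on (cball 0 R) (\<lambda>x. x $ 2 * eval2 p x)"
      using lip_mult[OF coord coord_bound pCons.IH] by blast
    ultimately show ?case
      using lipschitz_on_add by fastforce
  qed
qed

lemma closed_zero_locus: "closed (zero_locus p)"
  unfolding zero_locus_def using continuous_on_eval2[of UNIV p]
  by (intro closed_Collect_eq continuous_on_const)

section \<open>Lojasiewicz-type lower bounds for coprime polynomials\<close>

text \<open>The resultant is a nonzero polynomial in \<open>X\<close> of the form
  \<open>A * f + B * g\<close>. Near \<open>0\<close> it is comparable to a power of
  \<open>X\<close> whose exponent, its order of vanishing there, is at most its degree and hence at
  most \<open>d * e\<close>.\<close>

lemma coprime_first_coordinate_bound:
  assumes "coprime f g" "total_degree f \<le> d" "total_degree g \<le> e"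
    and f0: "eval2 f 0 = 0" and g0: "eval2 g 0 = 0"
  shows "\<exists>c r. c > 0 \<and> r > 0 \<and> (\<forall>x. norm x \<le> r \<longrightarrow>
    c * \<bar>x $ 1\<bar> ^ (d * e) \<le> \<bar>eval2 f x\<bar> + \<bar>eval2 g x\<bar>)"
proof -
  \<comment> \<open>Otherwise both are polynomials in \<open>X\<close> alone that vanish at
    \<open>0\<close>, and share the factor \<open>X\<close>, written
    \<open>[:[:0, 1:]:]\<close>.\<close>
  have "degree f + degree g > 0"
  proof (rule ccontr)
    assume "\<not> degree f + degree g > 0"
    then obtain a b where ab: "f = [:a:]" "g = [:b:]"
      by (metis add_is_0 degree_eq_zeroE neq0_conv)
    then have "[:0, 1:] dvd a" "[:0, 1:] dvd b"
      using f0 g0 poly_eq_0_iff_dvd[of _ 0] by auto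
    then have "[:[:0, 1:]:] dvd f" "[:[:0, 1:]:] dvd g"
      unfolding ab const_poly_dvd .
    then have "is_unit [:[:0, 1 :: real:]:]"
      using assms(1) coprime_common_divisor by blast
    then show False
      by (simp add: is_unit_const_poly_iff is_unit_pCons_iff)
  qed
  then obtain A B where AB: "[:resultant f g:] = A * f + B * g"
    using resultant_in_ideal[of f g] by auto
  define R where "R = resultant f g"
  have R0: "R \<noteq> 0"
    using assms(1) unfolding R_def resultant_0_gcd by simp
  then obtain S where S: "R = [:- 0, 1:] ^ order 0 R * S" "\<not> [:- 0, 1:] dvd S"
    using order_decomp by blast
  define k where "k = order 0 R"
  have k: "k \<le> d * e"
    using order_degree[OF R0, of 0] degree_resultant_le[OF assms(2,3)]
    unfolding k_def R_def by linarith
  have S0: "poly S 0 \<noteq> 0"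
    using S(2) by (simp add: poly_eq_0_iff_dvd)
  obtain s where s: "s > 0" "\<And>t. \<bar>t\<bar> < s \<Longrightarrow> \<bar>poly S t - poly S 0\<bar> < \<bar>poly S 0\<bar> / 2"
    using poly_isCont[of 0 S] S0 unfolding continuous_at_eps_delta dist_real_def
    by (metis abs_zero diff_zero half_gt_zero zero_less_abs_iff)
  obtain K1 where K1: "K1 > 0" "\<And>x. x \<in> cball 0 1 \<Longrightarrow> \<bar>eval2 A x\<bar> \<le> K1"
    using eval2_bounded[of 1 A] by blast
  obtain K2 where K2: "K2 > 0" "\<And>x. x \<in> cball 0 1 \<Longrightarrow> \<bar>eval2 B x\<bar> \<le> K2"
    using eval2_bounded[of 1 B] by blast
  \<comment> \<open>Near \<open>0\<close> the cofactor \<open>S\<close> keeps at least half of its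
    absolute value at \<open>0\<close>, while \<open>K1 + K2\<close> dominates both \<open>A\<close>
    and \<open>B\<close> on the unit ball.\<close>
  define c where "c = \<bar>poly S 0\<bar> / 2 / (K1 + K2)"
  define r where "r = min 1 (s / 2)"
  have "c * \<bar>x $ 1\<bar> ^ (d * e) \<le> \<bar>eval2 f x\<bar> + \<bar>eval2 g x\<bar>" if x: "norm x \<le> r" for x
  proof -
    have x1: "\<bar>x $ 1\<bar> \<le> 1" "\<bar>x $ 1\<bar> < s"
      using x component_le_norm_cart[of x 1] s(1) by (auto simp: r_def)
    have "\<bar>poly S 0\<bar> / 2 \<le> \<bar>poly S (x $ 1)\<bar>"
      using s(2)[OF x1(2)] by linarith
    moreover have "\<bar>x $ 1\<bar> ^ (d * e) \<le> \<bar>x $ 1\<bar> ^ k"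
      using x1(1) k by (intro power_decreasing) auto
    ultimately have "\<bar>poly S 0\<bar> / 2 * \<bar>x $ 1\<bar> ^ (d * e) \<le> \<bar>poly S (x $ 1)\<bar> * \<bar>x $ 1\<bar> ^ k"
      by (intro mult_mono) auto
    also have "\<dots> = \<bar>poly R (x $ 1)\<bar>"
      by (subst S(1)) (simp add: k_def abs_mult power_abs)
    also have "poly R (x $ 1) = eval2 A x * eval2 f x + eval2 B x * eval2 g x"
      using arg_cong[OF AB, of "\<lambda>p. eval2 p x"] by (simp add: R_def)
    also have "\<bar>\<dots>\<bar> \<le> \<bar>eval2 A x\<bar> * \<bar>eval2 f x\<bar> + \<bar>eval2 B x\<bar> * \<bar>eval2 g x\<bar>"
      by (metis abs_mult abs_triangle_ineq)
    also have "\<dots> \<le> (K1 + K2) * \<bar>eval2 f x\<bar> + (K1 + K2) * \<bar>eval2 g x\<bar>"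
      using K1(1) K2(1) K1(2)[of x] K2(2)[of x] x
      by (intro add_mono mult_right_mono) (auto simp: r_def)
    finally show ?thesis
      using K1(1) K2(1) by (simp add: c_def field_simps)
  qed
  moreover have "c > 0" "r > 0"
    using S0 K1(1) K2(1) s(1) by (auto simp: c_def r_def)
  ultimately show ?thesis by blast
qed

text \<open>The one-coordinate bound is applied to the pair and to its exchanged form. The larger
  coordinate is at least \<open>norm x / 2\<close> in absolute value, which costs the factor
  \<open>2 ^ (d * e)\<close>.\<close>

lemma coprime_lojasiewicz:
  assumes "coprime f g" "total_degree f \<le> d" "total_degree g \<le> e"
    and f0: "eval2 f 0 = 0" and g0: "eval2 g 0 = 0"
  shows "\<exists>c r. c > 0 \<and> r > 0 \<and> (\<forall>x. norm x \<le> r \<longrightarrow>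
    c * norm x ^ (d * e) \<le> \<bar>eval2 f x\<bar> + \<bar>eval2 g x\<bar>)"
proof -
  obtain c1 r1 where 1: "c1 > 0" "r1 > 0"
    "\<And>x. norm x \<le> r1 \<Longrightarrow> c1 * \<bar>x $ 1\<bar> ^ (d * e) \<le> \<bar>eval2 f x\<bar> + \<bar>eval2 g x\<bar>"
    using coprime_first_coordinate_bound[OF assms] by blast
  let ?s = "\<lambda>x :: real^2. vector [x $ 2, x $ 1] :: real^2"
  have "?s 0 = 0"
    by (simp add: Finite_Cartesian_Product.vec_eq_iff forall_2 vector_2)
  then obtain c2 r2 where 2: "c2 > 0" "r2 > 0"
    "\<And>x. norm x \<le> r2 \<Longrightarrow> c2 * \<bar>x $ 1\<bar> ^ (d * e) \<le> \<bar>eval2 f (?s x)\<bar> + \<bar>eval2 g (?s x)\<bar>"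
    using coprime_first_coordinate_bound[OF coprime_swap_vars[OF assms(1)]
      total_degree_swap_vars_le[OF assms(2)] total_degree_swap_vars_le[OF assms(3)]] f0 g0
    by (auto simp: eval2_swap_vars)
  define c where "c = min c1 c2 / 2 ^ (d * e)"
  have "c * norm x ^ (d * e) \<le> \<bar>eval2 f x\<bar> + \<bar>eval2 g x\<bar>" if x: "norm x \<le> min r1 r2" for x
  proof -
    have "norm (?s x) = norm x"
      by (simp add: norm_vec_def L2_set_def sum_2 add.commute)
    moreover have "?s (?s x) = x"
      by (simp add: Finite_Cartesian_Product.vec_eq_iff forall_2)
    ultimately have b2: "c2 * \<bar>x $ 2\<bar> ^ (d * e) \<le> \<bar>eval2 f x\<bar> + \<bar>eval2 g x\<bar>"
      using 2(3)[of "?s x"] x by simp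
    have b1: "c1 * \<bar>x $ 1\<bar> ^ (d * e) \<le> \<bar>eval2 f x\<bar> + \<bar>eval2 g x\<bar>"
      using 1(3) x by simp
    have "norm x \<le> \<bar>x $ 1\<bar> + \<bar>x $ 2\<bar>"
      using norm_le_l1_cart[of x] by (simp add: sum_2)
    then have "norm x / 2 \<le> \<bar>x $ 1\<bar> \<or> norm x / 2 \<le> \<bar>x $ 2\<bar>"
      by linarith
    then have "min c1 c2 * (norm x / 2) ^ (d * e) \<le> \<bar>eval2 f x\<bar> + \<bar>eval2 g x\<bar>"
    proof
      assume "norm x / 2 \<le> \<bar>x $ 1\<bar>"
      then have "min c1 c2 * (norm x / 2) ^ (d * e) \<le> c1 * \<bar>x $ 1\<bar> ^ (d * e)"
        using 1(1) by (intro mult_mono power_mono) auto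
      with b1 show ?thesis by linarith
    next
      assume "norm x / 2 \<le> \<bar>x $ 2\<bar>"
      then have "min c1 c2 * (norm x / 2) ^ (d * e) \<le> c2 * \<bar>x $ 2\<bar> ^ (d * e)"
        using 2(1) by (intro mult_mono power_mono) auto
      with b2 show ?thesis by linarith
    qed
    then show ?thesis
      by (simp add: c_def power_divide)
  qed
  moreover have "c > 0" "min r1 r2 > 0"
    using 1 2 by (auto simp: c_def)
  ultimately show ?thesis by blast
qed

text \<open>The ball of radius \<open>2\<close> leaves room for zeros \<open>z\<close> with
  \<open>norm z \<le> 2 * norm x\<close>, the range in which nearest points will lie.\<close>

lemma abs_eval2_le_dist:
  assumes "L-lipschitz_on (cball 0 2) (eval2 p)" "norm x \<le> 1" "norm z \<le> 2" "z \<in> zero_locus p"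
  shows "\<bar>eval2 p x\<bar> \<le> L * dist x z"
  using lipschitz_onD[OF assms(1), of x z] assms(2-) by (simp add: zero_locus_def dist_real_def)

lemma eval2_nonzero_near_0:
  assumes "eval2 p 0 \<noteq> 0"
  obtains r where "r > 0" "\<And>z. norm z < r \<Longrightarrow> z \<notin> zero_locus p"
proof -
  have "open (- zero_locus p)" "0 \<in> - zero_locus p"
    using closed_zero_locus assms by (auto simp: zero_locus_def)
  then obtain r where "r > 0" "ball 0 r \<subseteq> - zero_locus p"
    using open_contains_ball by blast
  then show ?thesis
    by (intro that[of r]) auto
qed

text \<open>Here \<open>z\<close> and \<open>w\<close> stand for nearest points. Quantifying over
  them avoids \<open>infdist\<close> to a possibly empty locus, which is \<open>0\<close> by
  convention. If both polynomials vanish at \<open>0\<close>, the Lipschitz property turns their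
  values into distances; otherwise no such pair exists near \<open>0\<close>.\<close>

lemma coprime_zero_loci_separated:
  assumes "coprime f g" "total_degree f \<le> d" "total_degree g \<le> d"
  shows "\<exists>C r. C > 0 \<and> r > 0 \<and> (\<forall>x z w. norm x \<le> r \<longrightarrow> norm z \<le> 2 * norm x \<longrightarrow>
    norm w \<le> 2 * norm x \<longrightarrow> z \<in> zero_locus f \<longrightarrow> w \<in> zero_locus g \<longrightarrow>
    C * norm x ^ (d * d) \<le> dist x z + dist x w)"
proof (cases "eval2 f 0 = 0 \<and> eval2 g 0 = 0")
  case True
  obtain c r where c: "c > 0" "r > 0"
    "\<And>x. norm x \<le> r \<Longrightarrow> c * norm x ^ (d * d) \<le> \<bar>eval2 f x\<bar> + \<bar>eval2 g x\<bar>"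
    using coprime_lojasiewicz[OF assms] True by blast
  obtain L M where L: "L-lipschitz_on (cball 0 2) (eval2 f)" and M: "M-lipschitz_on (cball 0 2) (eval2 g)"
    using eval2_lipschitz by blast
  have LM: "L \<ge> 0" "M \<ge> 0"
    using L M lipschitz_on_nonneg by blast+
  \<comment> \<open>The summand \<open>1\<close> keeps the denominator positive even if both
    Lipschitz constants are \<open>0\<close>.\<close>
  have "c / (L + M + 1) * norm x ^ (d * d) \<le> dist x z + dist x w"
    if "norm x \<le> min 1 r" "norm z \<le> 2 * norm x" "norm w \<le> 2 * norm x"
      "z \<in> zero_locus f" "w \<in> zero_locus g" for x z w
  proof -
    have "c * norm x ^ (d * d) \<le> \<bar>eval2 f x\<bar> + \<bar>eval2 g x\<bar>"
      using c(3) that by simp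
    also have "\<dots> \<le> L * dist x z + M * dist x w"
      using that by (intro add_mono abs_eval2_le_dist[OF L] abs_eval2_le_dist[OF M]) auto
    also have "\<dots> \<le> (L + M + 1) * dist x z + (L + M + 1) * dist x w"
      using LM by (intro add_mono mult_right_mono) auto
    finally show ?thesis
      using LM by (simp add: field_simps)
  qed
  then show ?thesis
    using True c(1,2) LM by (intro exI[of _ "c / (L + M + 1)"] exI[of _ "min 1 r"]) auto
next
  case False
  then obtain p where p: "p = f \<or> p = g" "eval2 p 0 \<noteq> 0"
    by blast
  obtain r where r: "r > 0" "\<And>z. norm z < r \<Longrightarrow> z \<notin> zero_locus p"
    using eval2_nonzero_near_0[OF p(2)] by blast
  \<comment> \<open>With \<open>norm x \<le> r / 3\<close> both points have norm at most
    \<open>2 * r / 3 < r\<close>, inside the zero-free ball of \<open>p\<close>.\<close>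
  have "\<not> (z \<in> zero_locus f \<and> w \<in> zero_locus g)"
    if "norm x \<le> r / 3" "norm z \<le> 2 * norm x" "norm w \<le> 2 * norm x" for x z w :: "real^2"
    using p(1) r(1) r(2)[of z] r(2)[of w] that by auto
  then show ?thesis
    using r(1) by (intro exI[of _ 1] exI[of _ "r / 3"]) auto
qed

section \<open>From coprime cofactors to arbitrary pairs\<close>

lemma zero_locus_mult: "zero_locus (p * q) = zero_locus p \<union> zero_locus q"
  by (auto simp: zero_locus_def)

text \<open>A nearest point is no farther from \<open>x\<close> than \<open>a\<close> is, and the
  triangle inequality through \<open>x\<close> gives the factor \<open>2\<close>. With
  \<open>a\<close> the origin, nearest points stay where the local estimates hold.\<close>

lemma infdist_attained_near:
  fixes S :: "'a::heine_borel set"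
  assumes "closed S" "a \<in> S"
  obtains z where "z \<in> S" "infdist x S = dist x z" "dist a z \<le> 2 * dist a x"
proof -
  obtain z where z: "z \<in> S" "infdist x S = dist x z"
    using infdist_attains_inf[OF assms(1), of x] assms(2) by blast
  have "dist x z \<le> dist x a"
    using infdist_le[OF assms(2), of x] z(2) by simp
  then have "dist a z \<le> 2 * dist a x"
    using dist_triangle[of a z x] by (simp add: dist_commute)
  with z show ?thesis
    by (rule that)
qed

theorem theorem4p1:
  fixes f g :: "real poly poly" and d :: nat
  assumes "total_degree f \<le> d" and "total_degree g \<le> d"
    and "eval2 f 0 = 0" and "eval2 g 0 = 0"
  shows "\<exists>C r :: real. C > 0 \<and> r > 0 \<and>
    (\<forall>x :: real^2. norm x \<le> r \<longrightarrow>
      infdist x (zero_locus f) + infdist x (zero_locus g)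
        \<ge> C * infdist x (zero_locus f \<inter> zero_locus g) powr (((2 * real d - 1)\<^sup>2 + 1) / 2))"
proof -
  define E where "E = ((2 * real d - 1)\<^sup>2 + 1) / 2"
  have E: "E = (real d)\<^sup>2 + (real d - 1)\<^sup>2"
    by (simp add: E_def power2_eq_square field_simps)
  then have Edd: "real (d * d) \<le> E"
    by (simp add: power2_eq_square)
  \<comment> \<open>For \<open>d = 0\<close> the real subtraction in
    \<open>(real d - 1)\<^sup>2\<close> still gives \<open>E = 1\<close>.\<close>
  have E1: "1 \<le> E"
  proof (cases "d = 0")
    case False
    then have "1 \<le> d * d" by (cases d) auto
    then show ?thesis using Edd by linarith
  qed (simp add: E)
  show ?thesis
  \<comment> \<open>The gcd is \<open>0\<close> exactly here, so no coprime cofactors are available;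
    but all distances are \<open>0\<close>, and so is \<open>0 powr E\<close>.\<close>
  proof (cases "f = 0 \<and> g = 0")
    case True
    then have "zero_locus f = UNIV" "zero_locus g = UNIV"
      by (auto simp: zero_locus_def)
    then show ?thesis
      by (intro exI[of _ 1]) simp
  next
    case False
    define h where "h = gcd f g"
    define f1 g1 where "f1 = f div h" and "g1 = g div h"
    have fg: "f = h * f1" "g = h * g1"
      by (simp_all add: f1_def g1_def h_def)
    have cop: "coprime f1 g1"
      using False unfolding f1_def g1_def h_def by (intro div_gcd_coprime) auto
    have cofactor_degree: "total_degree q \<le> d" if "total_degree (h * q) \<le> d" for q
    proof (cases "q = 0")
      case True
      then show ?thesis by (simp add: total_degree_le_iff)
    next
      case False
      have "h \<noteq> 0" using \<open>\<not> (f = 0 \<and> g = 0)\<close> by (simp add: h_def)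
      then show ?thesis
        using total_degree_mult_ge[of h q] that False by simp
    qed
    have "total_degree f1 \<le> d" "total_degree g1 \<le> d"
      using assms(1,2) cofactor_degree fg by metis+
    then obtain C r where C: "C > 0" "r > 0"
      "\<And>x z w. norm x \<le> r \<Longrightarrow> norm z \<le> 2 * norm x \<Longrightarrow> norm w \<le> 2 * norm x \<Longrightarrow>
        z \<in> zero_locus f1 \<Longrightarrow> w \<in> zero_locus g1 \<Longrightarrow>
        C * norm x ^ (d * d) \<le> dist x z + dist x w"
      using coprime_zero_loci_separated[OF cop] by metis
    let ?V = "zero_locus f \<inter> zero_locus g"
    have V: "?V = zero_locus h \<union> (zero_locus f1 \<inter> zero_locus g1)"
      unfolding fg zero_locus_mult by blast
    have 0: "0 \<in> zero_locus f" "0 \<in> zero_locus g"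
      using assms(3,4) by (auto simp: zero_locus_def)
    \<comment> \<open>The constant \<open>1\<close> serves the case of a nearest point on the common
      component \<open>zero_locus h\<close>, and \<open>C\<close> the remaining case.\<close>
    have "min 1 C * infdist x ?V powr E \<le> infdist x (zero_locus f) + infdist x (zero_locus g)"
      if x: "norm x \<le> min 1 r" for x
    proof -
      obtain z where z: "z \<in> zero_locus f" "infdist x (zero_locus f) = dist x z" "norm z \<le> 2 * norm x"
        using infdist_attained_near[OF closed_zero_locus 0(1), of x] by auto
      obtain w where w: "w \<in> zero_locus g" "infdist x (zero_locus g) = dist x w" "norm w \<le> 2 * norm x"
        using infdist_attained_near[OF closed_zero_locus 0(2), of x] by auto
      have dV: "infdist x ?V \<le> norm x"
        using infdist_le[of 0 ?V x] 0 by simp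
      then have dV1: "infdist x ?V \<le> 1"
        using x by simp
      show ?thesis
      proof (cases "z \<in> zero_locus h \<or> w \<in> zero_locus h")
        case True
        \<comment> \<open>The base is at most \<open>1\<close>, so lowering the exponent from
          \<open>E\<close> to \<open>1\<close> only increases the power.\<close>
        have "min 1 C * infdist x ?V powr E \<le> 1 * infdist x ?V powr 1"
          using C(1) E1 dV1 infdist_nonneg[of x ?V] by (intro mult_mono powr_mono') auto
        also have "\<dots> = infdist x ?V"
          by (simp add: infdist_nonneg)
        also have "\<dots> \<le> dist x z + dist x w"
        proof -
          from True have "infdist x ?V \<le> dist x z \<or> infdist x ?V \<le> dist x w"
            unfolding V using infdist_le by blast
          then show ?thesis
            using zero_le_dist[of x z] zero_le_dist[of x w] by linarith
        qed
        finally show ?thesis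
          using z(2) w(2) by simp
      next
        case False
        then have "z \<in> zero_locus f1" "w \<in> zero_locus g1"
          using z(1) w(1) unfolding fg zero_locus_mult by auto
        then have C': "C * norm x ^ (d * d) \<le> dist x z + dist x w"
          using C(3) x z(3) w(3) by simp
        have "infdist x ?V powr E \<le> infdist x ?V powr real (d * d)"
          using Edd dV1 infdist_nonneg[of x ?V] by (intro powr_mono') auto
        also have "\<dots> \<le> norm x powr real (d * d)"
          using dV infdist_nonneg[of x ?V] by (intro powr_mono2) auto
        \<comment> \<open>Only an inequality: for \<open>x = 0\<close> and \<open>d = 0\<close> the
          left side is \<open>0 powr 0 = 0\<close>, while \<open>0 ^ 0 = 1\<close>.\<close>
        also have "\<dots> \<le> norm x ^ (d * d)"
          by (cases "x = 0") (auto simp: powr_realpow simp del: of_nat_mult)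
        finally have "min 1 C * infdist x ?V powr E \<le> C * norm x ^ (d * d)"
          using C(1) by (intro mult_mono) auto
        with C' show ?thesis
          using z(2) w(2) by simp
      qed
    qed
    then show ?thesis
      using C(1,2) unfolding E_def
      by (intro exI[of _ "min 1 C"] exI[of _ "min 1 r"]) auto
  qed
qed

end
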